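(* Let $\Sigma\subset\mathbb{R}^3$ be an immersed rotationally symmetric self-shrinking torus. Then $$\frac2re^{|x|^2/4}\cos\theta\qquad\text{and}\qquad\frac2re^{|x|^2/4}\sin\theta$$ are eigenfunctions of the stability operator $L_\Sigma$ with eigenvalue $-1$.
   Context: $x$ is the position vector in $\mathbb{R}^3$, with cylindrical coordinates $(r,\theta,z)$ and $|x|^2=r^2+z^2$. For an immersed oriented surface $\Sigma$ with unit normal $\mathbf{n}$, the second fundamental form is $A_\Sigma(v,w)=\langle\nabla_vw,\mathbf{n}\rangle$ and the mean curvature is $H_\Sigma=-\operatorname{tr}A_\Sigma$. A surface $\Sigma$ is a self-shrinker if $\sqrt{-t}\,\Sigma$, $t<0$, evolves by mean curvature flow $\dot x=-H_\Sigma\mathbf{n}$; equivalently $H_\Sigma=\frac12\langle x,\mathbf{n}\rangle$. A rotationally symmetric torus is generated by rotating, about the axis $\{r=0\}$, an immersed closed curve $\Gamma$ in the open half-plane $\{(r,z):r>0\}$. The stability operator acts on $f\colon\Sigma\to\mathbb{R}$ by $L_\Sigma f=\mathcal{L}_\Sigma f+|A_\Sigma|^2f+\frac12f$, where $\mathcal{L}_\Sigma f=e^{|x|^2/4}\operatorname{div}_\Sigma(e^{-|x|^2/4}\operatorname{grad}_\Sigma f)$. Sign convention: $f\ne0$ is an eigenfunction of $L$ with eigenvalue $\lambda$ if $-Lf=\lambda f$. *)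

theory Defs
  imports "HOL-Analysis.Analysis" "HOL-Analysis.Cross3"
begin

text \<open>
  An immersed torus in \<open>\<real>\<^sup>3\<close> is represented by an immersion \<open>X\<close> of \<open>\<real>\<^sup>2\<close> that is invariant under
  two independent translations.  A function on the (immersed) torus is then a function on the
  parameter plane with the same periods, so self-intersections of the image cause no ambiguity.
\<close>

definition partial :: "2 \<Rightarrow> (real^2 \<Rightarrow> 'b::real_normed_vector) \<Rightarrow> real^2 \<Rightarrow> 'b" where
  "partial i f p = vector_derivative (\<lambda>t. f (p + t *\<^sub>R axis i 1)) (at 0)"

text \<open>\<open>C\<^sup>\<infinity>\<close>: all iterated partial derivatives exist and are differentiable.\<close>

definition smooth :: "(real^2 \<Rightarrow> 'b::real_normed_vector) \<Rightarrow> bool" where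
  "smooth f \<longleftrightarrow> (\<forall>is p. foldr partial is f differentiable (at p))"

definition smooth_real :: "(real \<Rightarrow> real) \<Rightarrow> bool" where
  "smooth_real f \<longleftrightarrow> (\<forall>k s. (deriv ^^ k) f differentiable (at s))"

definition periodic_under :: "(real^2) set \<Rightarrow> (real^2 \<Rightarrow> 'b) \<Rightarrow> bool" where
  "periodic_under \<Lambda> f \<longleftrightarrow> (\<forall>v\<in>\<Lambda>. \<forall>p. f (p + v) = f p)"


subsection \<open>Geometry of an immersion of the plane, in its coordinate frame\<close>

definition induced_metric :: "(real^2 \<Rightarrow> real^3) \<Rightarrow> real^2 \<Rightarrow> real^2^2" where
  "induced_metric X p = (\<chi> i j. partial i X p \<bullet> partial j X p)"

abbreviation inv_metric :: "(real^2 \<Rightarrow> real^3) \<Rightarrow> real^2 \<Rightarrow> real^2^2" where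
  "inv_metric X p \<equiv> matrix_inv (induced_metric X p)"

text \<open>The orientation is the one induced by the parameters.\<close>

definition unit_normal :: "(real^2 \<Rightarrow> real^3) \<Rightarrow> real^2 \<Rightarrow> real^3" where
  "unit_normal X p = sgn (cross3 (partial 1 X p) (partial 2 X p))"

text \<open>\<open>A(\<partial>\<^sub>i,\<partial>\<^sub>j) = \<langle>\<nabla>\<^bsub>\<partial>\<^sub>i\<^esub> \<partial>\<^sub>j, n\<rangle>\<close>, with the Euclidean connection and \<open>\<partial>\<^sub>j\<close> the coordinate field \<open>\<partial>\<^sub>j X\<close>.\<close>

definition second_form :: "(real^2 \<Rightarrow> real^3) \<Rightarrow> real^2 \<Rightarrow> real^2^2" where
  "second_form X p = (\<chi> i j. partial i (partial j X) p \<bullet> unit_normal X p)"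

definition mean_curvature :: "(real^2 \<Rightarrow> real^3) \<Rightarrow> real^2 \<Rightarrow> real" where
  "mean_curvature X p =
     - (\<Sum>i\<in>UNIV. \<Sum>j\<in>UNIV. inv_metric X p $ i $ j * second_form X p $ i $ j)"

definition second_form_norm_sq :: "(real^2 \<Rightarrow> real^3) \<Rightarrow> real^2 \<Rightarrow> real" where
  "second_form_norm_sq X p =
     (\<Sum>i\<in>UNIV. \<Sum>j\<in>UNIV. \<Sum>k\<in>UNIV. \<Sum>l\<in>UNIV.
        inv_metric X p $ i $ k * inv_metric X p $ j $ l *
        second_form X p $ i $ j * second_form X p $ k $ l)"

definition surface_grad ::
    "(real^2 \<Rightarrow> real^3) \<Rightarrow> (real^2 \<Rightarrow> real) \<Rightarrow> real^2 \<Rightarrow> real^3" where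
  "surface_grad X f p =
     (\<Sum>i\<in>UNIV. \<Sum>j\<in>UNIV. (inv_metric X p $ i $ j * partial j f p) *\<^sub>R partial i X p)"

definition surface_div ::
    "(real^2 \<Rightarrow> real^3) \<Rightarrow> (real^2 \<Rightarrow> real^3) \<Rightarrow> real^2 \<Rightarrow> real" where
  "surface_div X V p =
     (\<Sum>i\<in>UNIV. \<Sum>j\<in>UNIV. inv_metric X p $ i $ j * (partial i V p \<bullet> partial j X p))"

definition drift_laplacian ::
    "(real^2 \<Rightarrow> real^3) \<Rightarrow> (real^2 \<Rightarrow> real) \<Rightarrow> real^2 \<Rightarrow> real" where
  "drift_laplacian X f p =
     exp ((norm (X p))\<^sup>2 / 4) *
     surface_div X (\<lambda>q. exp (- (norm (X q))\<^sup>2 / 4) *\<^sub>R surface_grad X f q) p"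

definition stability_operator ::
    "(real^2 \<Rightarrow> real^3) \<Rightarrow> (real^2 \<Rightarrow> real) \<Rightarrow> real^2 \<Rightarrow> real" where
  "stability_operator X f p =
     drift_laplacian X f p + second_form_norm_sq X p * f p + 1/2 * f p"

text \<open>Sign convention: \<open>-L f = \<mu> f\<close>.  The first two conditions say that \<open>f\<close> is a smooth function
  on the surface obtained from the parameter plane by dividing out the periods \<open>\<Lambda>\<close>.\<close>

definition stability_eigenfunction ::
    "(real^2) set \<Rightarrow> (real^2 \<Rightarrow> real^3) \<Rightarrow> real \<Rightarrow> (real^2 \<Rightarrow> real) \<Rightarrow> bool" where
  "stability_eigenfunction \<Lambda> X \<mu> f \<longleftrightarrow>
     smooth f \<and> periodic_under \<Lambda> f \<and> (\<exists>p. f p \<noteq> 0) \<and>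
     (\<forall>p. - stability_operator X f p = \<mu> * f p)"


subsection \<open>Self-shrinkers\<close>

text \<open>Mean curvature flow \<open>x' = -H n\<close> of the moving surface \<open>F t\<close>.  Tangential velocity only
  reparametrises the surface, so the equation is imposed on the normal velocity.\<close>

definition mean_curvature_flow :: "real set \<Rightarrow> (real \<Rightarrow> real^2 \<Rightarrow> real^3) \<Rightarrow> bool" where
  "mean_curvature_flow I F \<longleftrightarrow>
     (\<forall>t\<in>I. \<forall>p. \<exists>v. ((\<lambda>\<tau>. F \<tau> p) has_vector_derivative v) (at t) \<and>
        v \<bullet> unit_normal (F t) p = - mean_curvature (F t) p)"

definition self_shrinker :: "(real^2 \<Rightarrow> real^3) \<Rightarrow> bool" where
  "self_shrinker X \<longleftrightarrow> mean_curvature_flow {..<0} (\<lambda>t p. sqrt (- t) *\<^sub>R X p)"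

lemma partial_scaleR:
  fixes X :: "real^2 \<Rightarrow> real^3"
  assumes "smooth X"
  shows "partial i (\<lambda>p. c *\<^sub>R X p) p = c *\<^sub>R partial i X p"
    and "partial i (\<lambda>p. c *\<^sub>R partial j X p) p = c *\<^sub>R partial i (partial j X) p"
proof -
  have diff: "(\<lambda>t. f (p + t *\<^sub>R axis i 1)) differentiable (at 0)"
    if "f differentiable (at p)" for f :: "real^2 \<Rightarrow> real^3"
  proof -
    have "f differentiable (at (p + 0 *\<^sub>R axis i (1::real)))" using that by simp
    moreover have "(\<lambda>t::real. p + t *\<^sub>R axis i (1::real)) differentiable (at 0)"
      by (intro derivative_intros)
    ultimately show ?thesis
      using differentiable_chain_at[of "\<lambda>t. p + t *\<^sub>R axis i 1" "0::real" f]
      by (simp add: o_def)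
  qed
  have main: "partial i (\<lambda>p. c *\<^sub>R f p) p = c *\<^sub>R partial i f p"
    if "f differentiable (at p)" for f :: "real^2 \<Rightarrow> real^3"
    unfolding partial_def
    by (rule vector_derivative_at)
      (use diff[OF that] in \<open>auto intro!: derivative_eq_intros simp: vector_derivative_works\<close>)
  show "partial i (\<lambda>p. c *\<^sub>R X p) p = c *\<^sub>R partial i X p"
    using assms[unfolded smooth_def, rule_format, of "[]"] by (intro main[of X]) simp
  have "foldr partial [j] X differentiable (at p)"
    using assms unfolding smooth_def by blast
  then show "partial i (\<lambda>p. c *\<^sub>R partial j X p) p = c *\<^sub>R partial i (partial j X) p"
    by (intro main[of "partial j X"]) simp
qed

lemma matrix_inv_inverse:
  fixes A :: "real^2^2"
  assumes "invertible A"
  shows "A ** matrix_inv A = mat 1" "matrix_inv A ** A = mat 1"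
  using assms someI_ex[of "\<lambda>B. A ** B = mat 1 \<and> B ** A = mat 1"]
  unfolding invertible_def matrix_inv_def by auto

lemma matrix_inv_scaleR:
  fixes A :: "real^2^2"
  assumes "invertible A" "c \<noteq> 0"
  shows "matrix_inv (c *\<^sub>R A) = (1 / c) *\<^sub>R matrix_inv A"
proof -
  let ?B = "(1 / c) *\<^sub>R matrix_inv A"
  have AB: "(c *\<^sub>R A) ** ?B = mat 1" and BA: "?B ** (c *\<^sub>R A) = mat 1"
    using assms
    by (simp_all add: matrix_scalar_ac scalar_matrix_assoc[symmetric] matrix_inv_inverse)
  then have "(c *\<^sub>R A) ** matrix_inv (c *\<^sub>R A) = mat 1"
    by (intro matrix_inv_inverse) (auto simp: invertible_def)
  then show ?thesis
    by (metis BA matrix_mul_assoc matrix_mul_lid matrix_mul_rid)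
qed

lemma self_shrinker_iff:
  assumes X: "smooth X" and inv: "\<And>p. invertible (induced_metric X p)"
  shows "self_shrinker X \<longleftrightarrow> (\<forall>p. mean_curvature X p = 1/2 * (X p \<bullet> unit_normal X p))"
proof -
  have normal: "unit_normal (\<lambda>p. c *\<^sub>R X p) p = unit_normal X p" if "c > 0" for c p
    using that by (simp add: unit_normal_def partial_scaleR[OF X] cross_mult_left
        cross_mult_right sgn_scaleR)
  have metr: "induced_metric (\<lambda>p. c *\<^sub>R X p) p = (c * c) *\<^sub>R induced_metric X p" for c p
    by (simp add: induced_metric_def partial_scaleR[OF X] vec_eq_iff)
  have second: "second_form (\<lambda>p. c *\<^sub>R X p) p = c *\<^sub>R second_form X p" if "c > 0" for c p
    using that
    by (simp add: second_form_def normal partial_scaleR[OF X] vec_eq_iff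
        partial_scaleR(1)[OF X, abs_def])
  have mean: "mean_curvature (\<lambda>p. c *\<^sub>R X p) p = mean_curvature X p / c" if "c > 0" for c p
    using that inv[of p]
    by (simp add: mean_curvature_def second metr matrix_inv_scaleR sum_2 field_simps)
  have vel: "((\<lambda>\<tau>. sqrt (- \<tau>) *\<^sub>R X p) has_vector_derivative (- 1 / (2 * sqrt (- t))) *\<^sub>R X p) (at t)"
    if "t < 0" for t p
    using that
    by (auto intro!: derivative_eq_intros simp: field_simps)
  show ?thesis
  proof
    assume "self_shrinker X"
    then obtain v where v: "((\<lambda>\<tau>. sqrt (- \<tau>) *\<^sub>R X p) has_vector_derivative v p) (at (- 1))"
        "v p \<bullet> unit_normal X p = - mean_curvature X p" for p
      unfolding self_shrinker_def mean_curvature_flow_def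
      by (auto dest!: bspec[of _ _ "- 1"] simp: choice_iff) blast
    show "\<forall>p. mean_curvature X p = 1/2 * (X p \<bullet> unit_normal X p)"
      using v vector_derivative_unique_at[OF v(1) vel] by fastforce
  next
    assume H: "\<forall>p. mean_curvature X p = 1/2 * (X p \<bullet> unit_normal X p)"
    show "self_shrinker X"
      unfolding self_shrinker_def mean_curvature_flow_def
    proof (intro ballI allI exI conjI)
      fix t :: real and p assume "t \<in> {..<0}"
      then have t: "t < 0" by simp
      show "((\<lambda>\<tau>. sqrt (- \<tau>) *\<^sub>R X p) has_vector_derivative (- 1 / (2 * sqrt (- t))) *\<^sub>R X p) (at t)"
        by (rule vel[OF t])
      show "((- 1 / (2 * sqrt (- t))) *\<^sub>R X p) \<bullet> unit_normal (\<lambda>p. sqrt (- t) *\<^sub>R X p) p =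
            - mean_curvature (\<lambda>p. sqrt (- t) *\<^sub>R X p) p"
        using t H[rule_format, of p] by (simp add: normal mean field_simps)
    qed
  qed
qed


subsection \<open>Rotationally symmetric tori\<close>

text \<open>A \<open>T\<close>-periodic parametrisation \<open>s \<mapsto> (r s, z s)\<close> of an immersed closed curve in \<open>{r > 0}\<close>.\<close>

definition closed_profile_curve :: "real \<Rightarrow> (real \<Rightarrow> real) \<Rightarrow> (real \<Rightarrow> real) \<Rightarrow> bool" where
  "closed_profile_curve T r z \<longleftrightarrow>
     T > 0 \<and> smooth_real r \<and> smooth_real z \<and>
     (\<forall>s. r (s + T) = r s \<and> z (s + T) = z s) \<and>
     (\<forall>s. (deriv r s, deriv z s) \<noteq> (0, 0)) \<and>
     (\<forall>s. r s > 0)"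

text \<open>The parameters are \<open>p = (s, \<theta>)\<close>, and the axis of rotation is the third coordinate axis.\<close>

definition rotation_surface :: "(real \<Rightarrow> real) \<Rightarrow> (real \<Rightarrow> real) \<Rightarrow> real^2 \<Rightarrow> real^3" where
  "rotation_surface r z p =
     vector [r (p $ 1) * cos (p $ 2), r (p $ 1) * sin (p $ 2), z (p $ 1)]"

definition torus_periods :: "real \<Rightarrow> (real^2) set" where
  "torus_periods T = {axis 1 T, axis 2 (2 * pi)}"

end

theory Submission
  imports Defs
begin

text \<open>
  Why the eigenvalue is \<open>-1\<close>.  Put \<open>\<sigma> = r exp (-|x|\<^sup>2/4)\<close>.  Rotating a profile curve gives a
  self-shrinker exactly when the curve is a geodesic of the conformal metric
  \<open>\<sigma>\<^sup>2 (dr\<^sup>2 + dz\<^sup>2)\<close> on the half-plane, since its length in this metric is a multiple of the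
  Gaussian-weighted area of the surface.  On rotationally invariant functions the stability operator
  is therefore the Jacobi operator of this geodesic in disguise: \<open>L f = \<sigma> (d\<^sup>2/dt\<^sup>2 + K) (\<sigma> f)\<close>, with
  \<open>t\<close> the conformal arc length and \<open>K\<close> the Gauss curvature.  For \<open>f = 1/\<sigma>\<close>, a normal field of
  constant conformal length, only the curvature survives:
  \<open>L (1/\<sigma>) = \<sigma> K = - (\<Delta> log \<sigma>) / \<sigma> = (1 + 1/r\<^sup>2) / \<sigma>\<close>.  Multiplying by \<open>cos \<theta>\<close> or \<open>sin \<theta>\<close> changes
  the operator by \<open>-1/r\<^sup>2\<close>, which removes exactly the nonconstant part of this factor.  Hence
  \<open>L (c(\<theta>) / \<sigma>) = c(\<theta>) / \<sigma>\<close> for both.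
  
  The proof carries out this cancellation in coordinates, for a profile curve of arbitrary speed.
  With \<open>g = diag (r'\<^sup>2 + z'\<^sup>2, r\<^sup>2)\<close>, the lemma \<open>X_divergence\<close> turns the drift Laplacian of
  \<open>amplitude s * c \<theta>\<close> into an ordinary differential expression in \<open>s\<close>; \<open>self_shrinker_ode\<close> is the
  geodesic equation; and \<open>radial_equation\<close> is the identity \<open>\<sigma> K - 1/(r\<^sup>2 \<sigma>) = 1/\<sigma>\<close>, written for
  \<open>2/\<sigma>\<close> and with the weight \<open>exp (-|x|\<^sup>2/4)\<close> divided into it.  Smoothness of the functions involved
  comes from families of functions closed under differentiation.
\<close>

section \<open>Smoothness by closed families of functions\<close>

text \<open>
  Both notions of smoothness ask something of every iterated derivative.  Instead of Leibniz or
  chain rules of all orders, it suffices to exhibit a family of differentiable functions that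
  contains the given one and is closed under a single derivative.
\<close>

lemma smooth_real_coinduct:
  assumes "f \<in> S" "\<And>g s. g \<in> S \<Longrightarrow> g differentiable (at s)" "\<And>g. g \<in> S \<Longrightarrow> deriv g \<in> S"
  shows "smooth_real f"
proof -
  have "(deriv ^^ k) f \<in> S" for k
    by (induction k) (use assms in auto)
  then show ?thesis
    using assms(2) by (auto simp: smooth_real_def)
qed

lemma smooth_coinduct:
  assumes "f \<in> S" "\<And>g p. g \<in> S \<Longrightarrow> g differentiable (at p)"
    and "\<And>g i. g \<in> S \<Longrightarrow> partial i g \<in> S"
  shows "smooth f"
proof -
  have "foldr partial is f \<in> S" for "is"
    by (induction "is") (use assms in auto)
  then show ?thesis
    using assms(2) by (auto simp: smooth_def)
qed

lemma smooth_real_DERIV: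
  assumes "smooth_real f"
  shows "(f has_real_derivative deriv f s) (at s)"
  using assms[unfolded smooth_real_def, rule_format, of 0 s]
  by (simp add: DERIV_deriv_iff_real_differentiable)

lemma smooth_real_deriv:
  assumes "smooth_real f"
  shows "smooth_real (deriv f)"
  unfolding smooth_real_def
proof (intro allI)
  fix k s
  show "(deriv ^^ k) (deriv f) differentiable (at s)"
    using assms[unfolded smooth_real_def, rule_format, of "Suc k" s]
    by (simp only: funpow_Suc_right comp_apply)
qed

lemma smooth_real_const: "smooth_real (\<lambda>_. a)"
proof (rule smooth_real_coinduct)
  show "(\<lambda>_. a) \<in> range (\<lambda>a _. a)"
    by blast
next
  fix g :: "real \<Rightarrow> real" and s
  assume "g \<in> range (\<lambda>a _. a)"
  then obtain b where g: "g = (\<lambda>_. b)"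
    by blast
  show "g differentiable (at s)"
    unfolding g by simp
  have "deriv g = (\<lambda>_. 0)"
    unfolding g by (simp add: fun_eq_iff)
  then show "deriv g \<in> range (\<lambda>a _. a)"
    by blast
qed

lemma smooth_real_trig: "smooth_real (\<lambda>s. a * cos s + b * sin s)"
proof (rule smooth_real_coinduct)
  show "(\<lambda>s. a * cos s + b * sin s) \<in> {\<lambda>s. a * cos s + b * sin s | a b. True}"
    by blast
next
  fix g :: "real \<Rightarrow> real" and s
  assume "g \<in> {\<lambda>s. a * cos s + b * sin s | a b. True}"
  then obtain a b where g: "g = (\<lambda>s. a * cos s + b * sin s)"
    by blast
  have D: "(g has_real_derivative b * cos s + (- a) * sin s) (at s)" for s
    unfolding g by (auto intro!: derivative_eq_intros)
  show "g differentiable (at s)"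
    using D real_differentiable_def by blast
  have "deriv g = (\<lambda>s. b * cos s + (- a) * sin s)"
    using D by (intro ext DERIV_imp_deriv)
  then show "deriv g \<in> {\<lambda>s. a * cos s + b * sin s | a b. True}"
    by blast
qed

text \<open>
  The product, quotient and chain rules express the derivative of such an expression by another one
  of the same kind, so this is a family to which the coinduction principle applies.
\<close>

inductive smooth_expr :: "(real \<Rightarrow> real) \<Rightarrow> bool" where
  base: "smooth_real f \<Longrightarrow> smooth_expr f"
| add: "smooth_expr f \<Longrightarrow> smooth_expr g \<Longrightarrow> smooth_expr (\<lambda>s. f s + g s)"
| mult: "smooth_expr f \<Longrightarrow> smooth_expr g \<Longrightarrow> smooth_expr (\<lambda>s. f s * g s)"
| inverse: "smooth_expr f \<Longrightarrow> (\<And>s. f s \<noteq> 0) \<Longrightarrow> smooth_expr (\<lambda>s. inverse (f s))"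
| exp: "smooth_expr f \<Longrightarrow> smooth_expr (\<lambda>s. exp (f s))"

lemma smooth_expr_derivative:
  assumes "smooth_expr f"
  shows "\<exists>f'. (\<forall>s. (f has_real_derivative f' s) (at s)) \<and> smooth_expr f'"
  using assms
proof induction
  case (base f)
  then show ?case
    using smooth_real_DERIV smooth_real_deriv smooth_expr.base by blast
next
  case (add f g)
  then obtain f' g' where "\<forall>s. (f has_real_derivative f' s) (at s)" "smooth_expr f'"
      "\<forall>s. (g has_real_derivative g' s) (at s)" "smooth_expr g'"
    by blast
  then show ?case
    by (intro exI[of _ "\<lambda>s. f' s + g' s"])
      (auto intro!: derivative_eq_intros smooth_expr.add)
next
  case (mult f g)
  then obtain f' g' where "\<forall>s. (f has_real_derivative f' s) (at s)" "smooth_expr f'"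
      "\<forall>s. (g has_real_derivative g' s) (at s)" "smooth_expr g'"
    by blast
  then show ?case
    using mult by (intro exI[of _ "\<lambda>s. f' s * g s + g' s * f s"])
      (auto intro!: DERIV_mult smooth_expr.add smooth_expr.mult)
next
  case (inverse f)
  then obtain f' where "\<forall>s. (f has_real_derivative f' s) (at s)" "smooth_expr f'"
    by blast
  moreover have "smooth_expr (\<lambda>s. (- 1) * (inverse (f s) * f' s * inverse (f s)))"
    using inverse calculation
    by (intro smooth_expr.mult smooth_expr.inverse smooth_expr.base[OF smooth_real_const])
  ultimately show ?case
    using inverse
    by (intro exI[of _ "\<lambda>s. (- 1) * (inverse (f s) * f' s * inverse (f s))"] conjI allI)
      (auto intro!: derivative_eq_intros)
next
  case (exp f)
  then obtain f' where "\<forall>s. (f has_real_derivative f' s) (at s)" "smooth_expr f'"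
    by blast
  then show ?case
    using exp by (intro exI[of _ "\<lambda>s. exp (f s) * f' s"])
      (auto intro!: derivative_eq_intros smooth_expr.mult smooth_expr.exp)
qed

lemma smooth_expr_smooth_real:
  assumes "smooth_expr f"
  shows "smooth_real f"
proof (rule smooth_real_coinduct)
  show "f \<in> Collect smooth_expr"
    using assms by simp
next
  fix g :: "real \<Rightarrow> real" and s
  assume "g \<in> Collect smooth_expr"
  then obtain g' where g': "\<And>s. (g has_real_derivative g' s) (at s)" "smooth_expr g'"
    using smooth_expr_derivative by blast
  then show "g differentiable (at s)"
    using real_differentiable_def by blast
  have "deriv g = g'"
    using g'(1) by (intro ext DERIV_imp_deriv)
  then show "deriv g \<in> Collect smooth_expr"
    using g'(2) by simp
qed

section \<open>Partial derivatives in the parameter plane\<close>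

text \<open>
  The curried form \<open>F s \<theta>\<close> lets the usual one-variable differentiation rules act on one parameter
  while the other one is a constant.
\<close>

lemma partial_1_eq:
  assumes "((\<lambda>s. F s (p $ 2)) has_vector_derivative D) (at (p $ 1))"
  shows "partial 1 (\<lambda>q. F (q $ 1) (q $ 2)) p = D"
proof -
  have "((\<lambda>s. F s (p $ 2)) \<circ> (\<lambda>t. p $ 1 + t) has_vector_derivative 1 *\<^sub>R D) (at 0)"
    by (rule vector_diff_chain_at) (use assms in \<open>auto intro!: derivative_eq_intros\<close>)
  then show ?thesis
    unfolding partial_def by (intro vector_derivative_at) (simp add: o_def axis_def)
qed

lemma partial_2_eq:
  assumes "(F (p $ 1) has_vector_derivative D) (at (p $ 2))"
  shows "partial 2 (\<lambda>q. F (q $ 1) (q $ 2)) p = D"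
proof -
  have "(F (p $ 1) \<circ> (\<lambda>t. p $ 2 + t) has_vector_derivative 1 *\<^sub>R D) (at 0)"
    by (rule vector_diff_chain_at) (use assms in \<open>auto intro!: derivative_eq_intros\<close>)
  then show ?thesis
    unfolding partial_def by (intro vector_derivative_at) (simp add: o_def axis_def)
qed

lemma smooth_partial:
  assumes "smooth f"
  shows "smooth (partial i f)"
  unfolding smooth_def
proof (intro allI)
  fix "is" p
  show "foldr partial is (partial i f) differentiable (at p)"
    using assms[unfolded smooth_def, rule_format, of "is @ [i]" p] by simp
qed

lemma smooth_differentiable:
  assumes "smooth f"
  shows "f differentiable (at p)"
  using assms[unfolded smooth_def, rule_format, of "[]" p] by simp

lemma partial_add:
  assumes "f differentiable (at p)" "g differentiable (at p)"
  shows "partial i (\<lambda>q. f q + g q) p = partial i f p + partial i g p"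
proof -
  have D: "((\<lambda>t. h (p + t *\<^sub>R axis i 1)) has_vector_derivative partial i h p) (at 0)"
    if "h differentiable (at p)" for h :: "real^2 \<Rightarrow> 'a"
  proof -
    have "h differentiable (at (p + 0 *\<^sub>R axis i (1::real)))"
      using that by simp
    moreover have "(\<lambda>t::real. p + t *\<^sub>R axis i (1::real)) differentiable (at 0)"
      by (intro derivative_intros)
    ultimately have "(\<lambda>t. h (p + t *\<^sub>R axis i 1)) differentiable (at 0)"
      using differentiable_chain_at[of "\<lambda>t. p + t *\<^sub>R axis i 1" "0::real" h]
      by (simp add: o_def)
    then show ?thesis
      by (simp add: partial_def vector_derivative_works)
  qed
  show ?thesis
    unfolding partial_def[of i "\<lambda>q. f q + g q"]
    by (intro vector_derivative_at has_vector_derivative_add D assms)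
qed

lemma smooth_add:
  assumes "smooth f" "smooth g"
  shows "smooth (\<lambda>p. f p + g p)"
proof (rule smooth_coinduct)
  show "(\<lambda>p. f p + g p) \<in> {\<lambda>p. f p + g p | f g. smooth f \<and> smooth g}"
    using assms by blast
next
  fix h :: "real^2 \<Rightarrow> 'a" and p i
  assume "h \<in> {\<lambda>p. f p + g p | f g. smooth f \<and> smooth g}"
  then obtain f g where h: "h = (\<lambda>p. f p + g p)" and fg: "smooth f" "smooth g"
    by blast
  show "h differentiable (at p)"
    unfolding h using fg by (intro differentiable_add smooth_differentiable)
  have "partial i h = (\<lambda>p. partial i f p + partial i g p)"
    unfolding h using fg by (intro ext partial_add smooth_differentiable)
  then show "partial i h \<in> {\<lambda>p. f p + g p | f g. smooth f \<and> smooth g}"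
    using fg smooth_partial by blast
qed

text \<open>
  Products \<open>g s * c \<theta>\<close> form a family closed under both partial derivatives.
\<close>

lemma smooth_separated:
  fixes e :: "'b::real_normed_vector"
  assumes "smooth_real g" "smooth_real c"
  shows "smooth (\<lambda>p. (g (p $ 1) * c (p $ 2)) *\<^sub>R e)"
proof (rule smooth_coinduct)
  let ?S = "{\<lambda>p. (g (p $ 1) * c (p $ 2)) *\<^sub>R e | g c. smooth_real g \<and> smooth_real c}"
  show "(\<lambda>p. (g (p $ 1) * c (p $ 2)) *\<^sub>R e) \<in> ?S"
    using assms by blast
  fix h :: "real^2 \<Rightarrow> 'b" and p and i :: 2
  assume "h \<in> ?S"
  then obtain g c where h: "h = (\<lambda>p. (g (p $ 1) * c (p $ 2)) *\<^sub>R e)"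
    and gc: "smooth_real g" "smooth_real c"
    by blast
  note D = smooth_real_DERIV[OF gc(1)] smooth_real_DERIV[OF gc(2)]
  have "(\<lambda>p. f (p $ j)) differentiable (at p)"
    if "\<And>s. (f has_real_derivative deriv f s) (at s)" for f :: "real \<Rightarrow> real" and j :: 2
  proof -
    have "(\<lambda>p::real^2. p $ j) differentiable (at p)"
      by (intro bounded_linear_imp_differentiable bounded_linear_vec_nth)
    moreover have "f differentiable (at (p $ j))"
      using that real_differentiable_def by blast
    ultimately show ?thesis
      using differentiable_chain_at[of "\<lambda>p. p $ j" p f] by (simp add: o_def)
  qed
  with D show "h differentiable (at p)"
    unfolding h by (intro differentiable_scaleR differentiable_mult differentiable_const) auto
  have 1: "partial 1 h = (\<lambda>p. (deriv g (p $ 1) * c (p $ 2)) *\<^sub>R e)"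
    unfolding h by (intro ext partial_1_eq) (auto intro!: derivative_eq_intros D)
  have 2: "partial 2 h = (\<lambda>p. (g (p $ 1) * deriv c (p $ 2)) *\<^sub>R e)"
    unfolding h by (intro ext partial_2_eq) (auto intro!: derivative_eq_intros D)
  show "partial i h \<in> ?S"
    using exhaust_2[of i] 1 2 gc smooth_real_deriv by blast
qed

section \<open>Geometry of a surface of revolution\<close>

text \<open>
  In the cylindrical frame every vector field of interest has coefficients depending on \<open>s\<close> alone,
  up to a factor in \<open>\<theta>\<close>, and inner products need no trigonometry.
\<close>

definition e_rad :: "real \<Rightarrow> real^3" where
  "e_rad \<theta> = vector [cos \<theta>, sin \<theta>, 0]"

definition e_ang :: "real \<Rightarrow> real^3" where
  "e_ang \<theta> = vector [- sin \<theta>, cos \<theta>, 0]"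

definition e_ax :: "real^3" where
  "e_ax = vector [0, 0, 1]"

lemma inner_3: "x \<bullet> y = x $ 1 * y $ 1 + x $ 2 * y $ 2 + x $ 3 * (y::real^3) $ 3"
  by (simp add: inner_vec_def sum_3)

lemma frame_inner [simp]:
  "e_rad \<theta> \<bullet> e_rad \<theta> = 1" "e_ang \<theta> \<bullet> e_ang \<theta> = 1" "e_ax \<bullet> e_ax = 1"
  "e_rad \<theta> \<bullet> e_ang \<theta> = 0" "e_ang \<theta> \<bullet> e_rad \<theta> = 0" "e_rad \<theta> \<bullet> e_ax = 0"
  "e_ax \<bullet> e_rad \<theta> = 0" "e_ang \<theta> \<bullet> e_ax = 0" "e_ax \<bullet> e_ang \<theta> = 0"
  by (simp_all add: inner_3 e_rad_def e_ang_def e_ax_def flip: power2_eq_square)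

lemma frame_cross:
  "cross3 (e_rad \<theta>) (e_ang \<theta>) = e_ax" "cross3 e_ax (e_ang \<theta>) = - e_rad \<theta>"
  by (simp_all add: vec_eq_iff forall_3 cross3_def e_rad_def e_ang_def e_ax_def
      flip: power2_eq_square)

lemma e_rad_deriv: "(e_rad has_vector_derivative e_ang \<theta>) (at \<theta>)"
proof -
  have *: "e_rad = (\<lambda>\<theta>. cos \<theta> *\<^sub>R axis 1 1 + sin \<theta> *\<^sub>R axis 2 1)"
    by (auto simp: e_rad_def fun_eq_iff vec_eq_iff forall_3 axis_def)
  show ?thesis
    unfolding * by (auto intro!: derivative_eq_intros
        simp: e_ang_def vec_eq_iff forall_3 axis_def)
qed

lemma e_ang_deriv: "(e_ang has_vector_derivative - e_rad \<theta>) (at \<theta>)"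
proof -
  have *: "e_ang = (\<lambda>\<theta>. (- sin \<theta>) *\<^sub>R axis 1 1 + cos \<theta> *\<^sub>R axis 2 1)"
    by (auto simp: e_ang_def fun_eq_iff vec_eq_iff forall_3 axis_def)
  show ?thesis
    unfolding * by (auto intro!: derivative_eq_intros
        simp: e_rad_def vec_eq_iff forall_3 axis_def)
qed

lemma matrix_inv_diagonal:
  fixes G :: "real^2^2"
  assumes "G $ 1 $ 1 = a" "G $ 2 $ 2 = b" "G $ 1 $ 2 = 0" "G $ 2 $ 1 = 0" "a \<noteq> 0" "b \<noteq> 0"
  shows "invertible G" "matrix_inv G $ 1 $ 1 = 1 / a" "matrix_inv G $ 2 $ 2 = 1 / b"
    "matrix_inv G $ 1 $ 2 = 0" "matrix_inv G $ 2 $ 1 = 0"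
proof -
  show inv: "invertible G"
    using assms by (simp add: invertible_det_nz det_2)
  have "matrix_inv G ** G = mat 1"
    using matrix_inv_inverse(2)[OF inv] .
  then have "\<forall>i j. (matrix_inv G ** G) $ i $ j = mat 1 $ i $ j"
    by simp
  then show "matrix_inv G $ 1 $ 1 = 1 / a" "matrix_inv G $ 2 $ 2 = 1 / b"
    "matrix_inv G $ 1 $ 2 = 0" "matrix_inv G $ 2 $ 1 = 0"
    using assms by (simp_all add: forall_2 matrix_matrix_mult_def sum_2 mat_def field_simps)
qed

locale profile_curve =
  fixes T :: real and r z :: "real \<Rightarrow> real"
  assumes profile: "closed_profile_curve T r z"
begin

abbreviation "r' \<equiv> deriv r"
abbreviation "z' \<equiv> deriv z"
abbreviation "r'' \<equiv> deriv r'"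
abbreviation "z'' \<equiv> deriv z'"
abbreviation "X \<equiv> rotation_surface r z"

definition speed_sq :: "real \<Rightarrow> real" where
  "speed_sq s = (r' s)\<^sup>2 + (z' s)\<^sup>2"

lemma r_pos: "r s > 0" and r_nz [simp]: "r s \<noteq> 0"
  using profile by (auto simp: closed_profile_curve_def less_le)

lemma speed_sq_pos: "speed_sq s > 0" and speed_sq_nz [simp]: "speed_sq s \<noteq> 0"
proof -
  show "speed_sq s > 0"
    using profile unfolding closed_profile_curve_def speed_sq_def
    by (metis sum_power2_gt_zero_iff)
  then show "speed_sq s \<noteq> 0"
    by simp
qed

lemma smooth_r: "smooth_real r" and smooth_z: "smooth_real z"
  using profile by (auto simp: closed_profile_curve_def)

lemma profile_DERIV:
  "(r has_real_derivative r' s) (at s)" "(z has_real_derivative z' s) (at s)"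
  "(r' has_real_derivative r'' s) (at s)" "(z' has_real_derivative z'' s) (at s)"
  by (intro smooth_real_DERIV smooth_real_deriv smooth_r smooth_z)+

lemma X_frame: "X = (\<lambda>p. r (p $ 1) *\<^sub>R e_rad (p $ 2) + z (p $ 1) *\<^sub>R e_ax)"
  by (auto simp: fun_eq_iff rotation_surface_def vec_eq_iff forall_3 e_rad_def e_ax_def)

lemma X_norm: "(norm (X p))\<^sup>2 = (r (p $ 1))\<^sup>2 + (z (p $ 1))\<^sup>2"
  unfolding power2_norm_eq_inner X_frame
  by (simp add: inner_simps power2_eq_square)

lemma smooth_X: "smooth X"
proof -
  have X: "X = (\<lambda>p. ((r (p $ 1) * (1 * cos (p $ 2) + 0 * sin (p $ 2))) *\<^sub>R axis 1 1
      + (r (p $ 1) * (0 * cos (p $ 2) + 1 * sin (p $ 2))) *\<^sub>R axis 2 1)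
      + (z (p $ 1) * 1) *\<^sub>R axis 3 1)"
    by (auto simp: fun_eq_iff rotation_surface_def vec_eq_iff forall_3 axis_def)
  show ?thesis
    unfolding X
    by (intro smooth_add smooth_separated[of r] smooth_separated[of z "\<lambda>_. 1"]
        smooth_r smooth_z smooth_real_const smooth_real_trig)
qed

lemma partial_X:
  "partial 1 X = (\<lambda>p. r' (p $ 1) *\<^sub>R e_rad (p $ 2) + z' (p $ 1) *\<^sub>R e_ax)"
  "partial 2 X = (\<lambda>p. r (p $ 1) *\<^sub>R e_ang (p $ 2))"
  unfolding X_frame
  by (intro ext partial_1_eq partial_2_eq;
      auto intro!: derivative_eq_intros profile_DERIV e_rad_deriv)+

lemma partial_partial_X:
  "partial 1 (partial 1 X) = (\<lambda>p. r'' (p $ 1) *\<^sub>R e_rad (p $ 2) + z'' (p $ 1) *\<^sub>R e_ax)"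
  "partial 2 (partial 1 X) = (\<lambda>p. r' (p $ 1) *\<^sub>R e_ang (p $ 2))"
  "partial 1 (partial 2 X) = (\<lambda>p. r' (p $ 1) *\<^sub>R e_ang (p $ 2))"
  "partial 2 (partial 2 X) = (\<lambda>p. - r (p $ 1) *\<^sub>R e_rad (p $ 2))"
  unfolding partial_X
  by (intro ext partial_1_eq partial_2_eq;
      auto intro!: derivative_eq_intros profile_DERIV e_rad_deriv e_ang_deriv)+

lemma X_metric:
  "induced_metric X p $ 1 $ 1 = speed_sq (p $ 1)" "induced_metric X p $ 2 $ 2 = (r (p $ 1))\<^sup>2"
  "induced_metric X p $ 1 $ 2 = 0" "induced_metric X p $ 2 $ 1 = 0"
  by (simp_all add: induced_metric_def partial_X inner_simps speed_sq_def power2_eq_square)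

lemma X_inv_metric:
  "invertible (induced_metric X p)"
  "inv_metric X p $ 1 $ 1 = 1 / speed_sq (p $ 1)" "inv_metric X p $ 2 $ 2 = 1 / (r (p $ 1))\<^sup>2"
  "inv_metric X p $ 1 $ 2 = 0" "inv_metric X p $ 2 $ 1 = 0"
  by (rule matrix_inv_diagonal[OF X_metric]; simp)+

lemma X_normal:
  "unit_normal X p = (1 / sqrt (speed_sq (p $ 1))) *\<^sub>R
     (- z' (p $ 1) *\<^sub>R e_rad (p $ 2) + r' (p $ 1) *\<^sub>R e_ax)" (is "_ = _ *\<^sub>R ?m")
proof -
  have "norm ?m = sqrt (speed_sq (p $ 1))"
    by (simp add: norm_eq_sqrt_inner inner_simps speed_sq_def power2_eq_square)
  moreover have "cross3 (partial 1 X p) (partial 2 X p) = r (p $ 1) *\<^sub>R ?m"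
    by (simp add: partial_X cross_add_left cross_mult_left cross_mult_right frame_cross
        scaleR_add_right)
  ultimately show ?thesis
    by (simp add: unit_normal_def sgn_scaleR r_pos) (simp add: sgn_div_norm divide_inverse)
qed

lemma X_second_form:
  "second_form X p $ 1 $ 1 =
     (r' (p $ 1) * z'' (p $ 1) - z' (p $ 1) * r'' (p $ 1)) / sqrt (speed_sq (p $ 1))"
  "second_form X p $ 2 $ 2 = r (p $ 1) * z' (p $ 1) / sqrt (speed_sq (p $ 1))"
  "second_form X p $ 1 $ 2 = 0" "second_form X p $ 2 $ 1 = 0"
  by (simp_all add: second_form_def X_normal partial_partial_X inner_simps field_simps)

text \<open>
  The sum of the squares of the two principal curvatures, that of the profile curve and that of the
  parallel circle.
\<close>

lemma X_second_form_norm_sq: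
  "second_form_norm_sq X p =
     (r' (p $ 1) * z'' (p $ 1) - z' (p $ 1) * r'' (p $ 1))\<^sup>2 / (speed_sq (p $ 1)) ^ 3
     + (z' (p $ 1))\<^sup>2 / ((r (p $ 1))\<^sup>2 * speed_sq (p $ 1))"
proof -
  \<comment> \<open>With the speed itself as a variable, the square roots in the second fundamental form disappear.\<close>
  obtain w where "w > 0" "speed_sq (p $ 1) = w\<^sup>2"
    using speed_sq_pos[of "p $ 1"] by (metis real_sqrt_gt_zero real_sqrt_pow2 less_imp_le)
  then show ?thesis
    by (simp add: second_form_norm_sq_def sum_2 X_inv_metric X_second_form)
      (simp add: power_divide power_mult_distrib eval_nat_numeral ac_simps)
qed

text \<open>
  The equation \<open>H = \<langle>x, n\<rangle>/2\<close> multiplied by \<open>- sqrt (speed_sq s)\<close>, which makes it rational in the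
  derivatives of \<open>r\<close> and \<open>z\<close>.
\<close>

lemma self_shrinker_ode:
  assumes "self_shrinker X"
  shows "(r' s * z'' s - z' s * r'' s) / speed_sq s + z' s / r s = (r s * z' s - z s * r' s) / 2"
proof -
  define p :: "real^2" where "p = vector [s, 0]"
  have p: "p $ 1 = s"
    by (simp add: p_def)
  obtain w where w: "w > 0" "speed_sq s = w\<^sup>2"
    using speed_sq_pos[of s] by (metis real_sqrt_gt_zero real_sqrt_pow2 less_imp_le)
  have "mean_curvature X p = 1/2 * (X p \<bullet> unit_normal X p)"
    using assms self_shrinker_iff[OF smooth_X X_inv_metric(1)] by blast
  moreover have "X p \<bullet> unit_normal X p = - (r s * z' s - z s * r' s) / w"
    unfolding X_normal unfolding X_frame using w
    by (simp add: inner_simps p diff_divide_distrib mult.commute)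
  moreover have "mean_curvature X p
      = - ((r' s * z'' s - z' s * r'' s) / speed_sq s + z' s / r s) / w"
    using w by (simp add: mean_curvature_def sum_2 X_inv_metric X_second_form p)
      (simp add: field_simps power2_eq_square)
  ultimately have "- ((r' s * z'' s - z' s * r'' s) / speed_sq s + z' s / r s) / w
      = 1/2 * (- (r s * z' s - z s * r' s) / w)"
    by simp
  moreover have "a = b / 2" if "- a / w = 1/2 * (- b / w)" for a b
    using that w(1) by (simp add: field_simps)
  ultimately show ?thesis
    by blast
qed

text \<open>
  This is \<open>(\<partial>\<^sub>1 (D V\<^sup>1) + \<partial>\<^sub>2 (D V\<^sup>2)) / D\<close> with the area density \<open>D = r * sqrt (speed_sq s)\<close>; the two
  fractions are the logarithmic derivatives of the two factors of \<open>D\<close>.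
\<close>

lemma X_divergence:
  assumes "(a has_real_derivative a') (at (p $ 1))" "(b has_real_derivative b') (at (p $ 1))"
    and "(c has_real_derivative c') (at (p $ 2))" "(d has_real_derivative d') (at (p $ 2))"
  shows "surface_div X (\<lambda>q. (a (q $ 1) * c (q $ 2)) *\<^sub>R partial 1 X q
                         + (b (q $ 1) * d (q $ 2)) *\<^sub>R partial 2 X q) p =
     (a' + a (p $ 1) * ((r' (p $ 1) * r'' (p $ 1) + z' (p $ 1) * z'' (p $ 1)) / speed_sq (p $ 1)
         + r' (p $ 1) / r (p $ 1))) * c (p $ 2) + b (p $ 1) * d'"
    (is "surface_div X ?V p = _")
proof -
  let ?s = "p $ 1" and ?\<theta> = "p $ 2"
  let ?F = "\<lambda>s \<theta>. (a s * c \<theta>) *\<^sub>R (r' s *\<^sub>R e_rad \<theta> + z' s *\<^sub>R e_ax)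
                  + (b s * d \<theta>) *\<^sub>R (r s *\<^sub>R e_ang \<theta>)"
  have V: "?V = (\<lambda>q. ?F (q $ 1) (q $ 2))"
    by (simp add: partial_X)
  have d1: "partial 1 ?V p
      = (a ?s * c ?\<theta>) *\<^sub>R (r'' ?s *\<^sub>R e_rad ?\<theta> + z'' ?s *\<^sub>R e_ax)
        + (a' * c ?\<theta>) *\<^sub>R (r' ?s *\<^sub>R e_rad ?\<theta> + z' ?s *\<^sub>R e_ax)
        + ((b ?s * d ?\<theta>) *\<^sub>R (r' ?s *\<^sub>R e_ang ?\<theta>) + (b' * d ?\<theta>) *\<^sub>R (r ?s *\<^sub>R e_ang ?\<theta>))"
    unfolding V
    by (rule partial_1_eq)
      (auto intro!: derivative_eq_intros profile_DERIV assms simp: algebra_simps)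
  have 1: "partial 1 ?V p \<bullet> partial 1 X p
      = a ?s * c ?\<theta> * (r' ?s * r'' ?s + z' ?s * z'' ?s) + a' * c ?\<theta> * speed_sq ?s"
    unfolding d1 unfolding partial_X
    by (simp add: inner_simps speed_sq_def power2_eq_square algebra_simps)
  have d2: "partial 2 ?V p
      = (a ?s * c ?\<theta>) *\<^sub>R (r' ?s *\<^sub>R e_ang ?\<theta>)
        + (a ?s * c') *\<^sub>R (r' ?s *\<^sub>R e_rad ?\<theta> + z' ?s *\<^sub>R e_ax)
        + ((b ?s * d ?\<theta>) *\<^sub>R (r ?s *\<^sub>R (- e_rad ?\<theta>)) + (b ?s * d') *\<^sub>R (r ?s *\<^sub>R e_ang ?\<theta>))"
    unfolding V
    by (rule partial_2_eq)
      (auto intro!: derivative_eq_intros profile_DERIV assms e_rad_deriv e_ang_deriv simp: ac_simps)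
  have 2: "partial 2 ?V p \<bullet> partial 2 X p
      = a ?s * c ?\<theta> * r' ?s * r ?s + b ?s * d' * (r ?s)\<^sup>2"
    unfolding d2 unfolding partial_X
    by (simp add: inner_simps power2_eq_square algebra_simps)
  show ?thesis
    unfolding surface_div_def sum_2 X_inv_metric
    by (simp add: 1 2) (simp add: field_simps power2_eq_square)
qed

section \<open>The modes of frequency one\<close>

definition amplitude :: "real \<Rightarrow> real" where
  "amplitude s = 2 / r s * exp (((r s)\<^sup>2 + (z s)\<^sup>2) / 4)"

lemma smooth_amplitude: "smooth_real amplitude"
proof -
  have eq: "amplitude = (\<lambda>s. (2 * inverse (r s)) * exp ((r s * r s + z s * z s) * (1/4)))"
    by (rule ext) (simp add: amplitude_def power2_eq_square field_simps)
  show ?thesis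
    unfolding eq
    by (intro smooth_expr_smooth_real smooth_expr.mult smooth_expr.add smooth_expr.inverse
        smooth_expr.exp r_nz smooth_expr.base[OF smooth_real_const]
        smooth_expr.base[OF smooth_r] smooth_expr.base[OF smooth_z])
qed

text \<open>
  This is \<open>exp (-|x|\<^sup>2/4) * amplitude' / speed_sq\<close>, the first coordinate component of the weighted
  gradient of \<open>amplitude\<close>.  The weight cancels the exponential in the amplitude, so only a rational
  expression remains.
\<close>

definition weighted_slope :: "real \<Rightarrow> real" where
  "weighted_slope s = (r' s + z s * z' s / r s - 2 * r' s / (r s)\<^sup>2) / speed_sq s"

lemma amplitude_DERIV:
  "(amplitude has_real_derivative
     exp (((r s)\<^sup>2 + (z s)\<^sup>2) / 4) * (speed_sq s * weighted_slope s)) (at s)"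
  unfolding amplitude_def weighted_slope_def
  by (auto intro!: derivative_eq_intros profile_DERIV) (simp add: field_simps power2_eq_square)

text \<open>
  The field whose divergence the drift Laplacian takes.  The weight cancels the exponential in
  the amplitude, which leaves components of the product form that \<open>X_divergence\<close> handles.
\<close>

lemma weighted_gradient:
  assumes "\<And>\<theta>. (c has_real_derivative c' \<theta>) (at \<theta>)"
  shows "exp (- (norm (X q))\<^sup>2 / 4) *\<^sub>R surface_grad X (\<lambda>p. amplitude (p $ 1) * c (p $ 2)) q
    = (weighted_slope (q $ 1) * c (q $ 2)) *\<^sub>R partial 1 X q
      + (2 / (r (q $ 1)) ^ 3 * c' (q $ 2)) *\<^sub>R partial 2 X q"
proof -
  define E F where E: "E = exp (((r (q $ 1))\<^sup>2 + (z (q $ 1))\<^sup>2) / 4)"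
    and F: "F = exp (- ((r (q $ 1))\<^sup>2 + (z (q $ 1))\<^sup>2) / 4)"
  have 1: "partial 1 (\<lambda>p. amplitude (p $ 1) * c (p $ 2)) q
      = E * (speed_sq (q $ 1) * weighted_slope (q $ 1)) * c (q $ 2)"
    unfolding E
    by (rule partial_1_eq)
      (auto intro!: derivative_eq_intros amplitude_DERIV
        simp: has_real_derivative_iff_has_vector_derivative[symmetric])
  have 2: "partial 2 (\<lambda>p. amplitude (p $ 1) * c (p $ 2)) q = 2 / r (q $ 1) * E * c' (q $ 2)"
    unfolding E amplitude_def[symmetric]
    by (rule partial_2_eq)
      (auto intro!: derivative_eq_intros assms
        simp: has_real_derivative_iff_has_vector_derivative[symmetric])
  have "F * E = 1"
    unfolding E F by (simp flip: exp_add) (simp add: field_simps)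
  then have cancel: "F * (E * y) = y" for y
    by (simp flip: mult.assoc)
  have "F *\<^sub>R surface_grad X (\<lambda>p. amplitude (p $ 1) * c (p $ 2)) q
    = (F * (E * (weighted_slope (q $ 1) * c (q $ 2)))) *\<^sub>R partial 1 X q
      + (F * (E * (2 / (r (q $ 1)) ^ 3 * c' (q $ 2)))) *\<^sub>R partial 2 X q"
    unfolding surface_grad_def sum_2 X_inv_metric 1 2
    by (simp add: scaleR_add_right) (simp add: eval_nat_numeral ac_simps)
  then show ?thesis
    unfolding cancel unfolding X_norm F .
qed

text \<open>
  The eigenvalue equation after removal of the common factor \<open>exp (|x|\<^sup>2/4) * c \<theta>\<close>, with the
  \<open>1/2\<close> of the stability operator moved to the right: \<open>2/r - (1/2) (2/r) = 1/r\<close>.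
  
  The second derivatives of the profile are split into their tangential part \<open>\<pi>\<close>, due to the
  parametrization, and their normal part \<open>\<kappa>\<close>, the curvature times the speed.  The terms with \<open>\<pi>\<close>
  cancel, as the equation is geometric.  The remaining terms are at most linear in \<open>\<kappa>\<close> before
  \<open>|A|\<^sup>2\<close> is added.  Replacing \<open>z r' - r z'\<close> by \<open>-2 (\<kappa> + z'/r)\<close>, which is the shrinker
  equation, produces a term in \<open>- \<kappa>\<^sup>2\<close> that cancels against \<open>|A|\<^sup>2\<close>, while the mixed terms
  \<open>\<kappa> z'\<close> cancel among themselves.
\<close>

lemma radial_equation:
  assumes "self_shrinker X"
  obtains a' where "(weighted_slope has_real_derivative a') (at s)"
    "a' + weighted_slope s * ((r' s * r'' s + z' s * z'' s) / speed_sq s + r' s / r s)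
       - 2 / r s ^ 3
     + ((r' s * z'' s - z' s * r'' s)\<^sup>2 / speed_sq s ^ 3
         + (z' s)\<^sup>2 / ((r s)\<^sup>2 * speed_sq s)) * (2 / r s)
     = 1 / r s"
proof -
  define \<rho> \<rho>1 \<rho>2 \<zeta> \<zeta>1 \<zeta>2 W where vars:
    "\<rho> = r s" "\<rho>1 = r' s" "\<rho>2 = r'' s" "\<zeta> = z s" "\<zeta>1 = z' s" "\<zeta>2 = z'' s" "W = speed_sq s"
  define N P where NP: "N = \<rho>1 * \<zeta>2 - \<zeta>1 * \<rho>2" "P = \<rho>1 * \<rho>2 + \<zeta>1 * \<zeta>2"
  define \<kappa> where "\<kappa> = N / W"
  \<comment> \<open>The numerator of \<open>weighted_slope\<close>, and below it its derivative.\<close>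
  define m where "m = \<rho>1 + \<zeta> * \<zeta>1 / \<rho> - 2 * \<rho>1 / \<rho>\<^sup>2"
  define m' where "m' = \<rho>2 + (\<zeta>1\<^sup>2 + \<zeta> * \<zeta>2) / \<rho> - \<zeta> * \<zeta>1 * \<rho>1 / \<rho>\<^sup>2
    - 2 * \<rho>2 / \<rho>\<^sup>2 + 4 * \<rho>1\<^sup>2 / \<rho> ^ 3"
  have nz: "\<rho> \<noteq> 0" "W \<noteq> 0"
    by (simp_all add: vars)
  have W: "W = \<rho>1\<^sup>2 + \<zeta>1\<^sup>2"
    by (simp add: vars speed_sq_def)
  have "(weighted_slope has_real_derivative (m' * W - m * (2 * P)) / W\<^sup>2) (at s)"
  proof -
    have "(speed_sq has_real_derivative 2 * P) (at s)"
      unfolding speed_sq_def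
      by (auto intro!: derivative_eq_intros profile_DERIV simp: vars NP)
    moreover have "((\<lambda>s. r' s + z s * z' s / r s - 2 * r' s / (r s)\<^sup>2) has_real_derivative m') (at s)"
      using nz by (auto intro!: derivative_eq_intros profile_DERIV simp: m'_def vars)
        (simp add: field_simps eval_nat_numeral)
    ultimately show ?thesis
      unfolding weighted_slope_def using DERIV_divide[of _ m' s UNIV speed_sq "2 * P"]
      by (simp add: m_def vars power2_eq_square)
  qed
  moreover have "(m' * W - m * (2 * P)) / W\<^sup>2 + m / W * (P / W + \<rho>1 / \<rho>) - 2 / \<rho> ^ 3
      + (N\<^sup>2 / W ^ 3 + \<zeta>1\<^sup>2 / (\<rho>\<^sup>2 * W)) * (2 / \<rho>) = 1 / \<rho>" (is "?L = _")
  proof -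
    have ode: "\<kappa> + \<zeta>1 / \<rho> = (\<rho> * \<zeta>1 - \<zeta> * \<rho>1) / 2"
      using self_shrinker_ode[OF assms, of s] by (simp add: \<kappa>_def NP vars)
    define \<pi> where "\<pi> = P / W"
    \<comment> \<open>The acceleration in the basis formed by the tangent \<open>(\<rho>1, \<zeta>1)\<close> and the normal \<open>(- \<zeta>1, \<rho>1)\<close>.\<close>
    have \<rho>2: "\<rho>2 = \<pi> * \<rho>1 - \<kappa> * \<zeta>1" and \<zeta>2: "\<zeta>2 = \<pi> * \<zeta>1 + \<kappa> * \<rho>1"
      using nz(2) unfolding \<pi>_def \<kappa>_def
      by (simp_all add: eq_divide_eq diff_divide_distrib[symmetric] add_divide_distrib[symmetric])
        (simp_all add: W NP power2_eq_square algebra_simps)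
    \<comment> \<open>The bracket is what the Laplacian leaves besides curvature; its last term cancels the one from \<open>r'/r\<close>.\<close>
    have "m' = \<pi> * m + \<kappa> * (\<zeta> * \<rho>1 - \<rho> * \<zeta>1) / \<rho> + 2 * \<kappa> * \<zeta>1 / \<rho>\<^sup>2
        + (W / \<rho> + 2 * \<rho>1\<^sup>2 / \<rho> ^ 3 - m * \<rho>1 / \<rho>)"
      unfolding m'_def m_def \<rho>2 \<zeta>2 W using nz(1)
      by (simp add: field_simps eval_nat_numeral)
    \<comment> \<open>The only use of the shrinker equation.\<close>
    also have "\<zeta> * \<rho>1 - \<rho> * \<zeta>1 = - 2 * (\<kappa> + \<zeta>1 / \<rho>)"
      using ode by simp
    finally have "m' = \<pi> * m - 2 * \<kappa>\<^sup>2 / \<rho> + (W / \<rho> + 2 * \<rho>1\<^sup>2 / \<rho> ^ 3 - m * \<rho>1 / \<rho>)"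
      by (simp add: algebra_simps add_divide_distrib diff_divide_distrib eval_nat_numeral)
    then have m': "m' / W = \<pi> * m / W - 2 * \<kappa>\<^sup>2 / \<rho> / W
        + 1 / \<rho> + 2 * \<rho>1\<^sup>2 / \<rho> ^ 3 / W - m * \<rho>1 / \<rho> / W"
      using nz(2) by (simp add: add_divide_distrib diff_divide_distrib)
    have PN: "P = \<pi> * W" "N = \<kappa> * W"
      using nz(2) by (simp_all add: \<pi>_def \<kappa>_def)
    have "(m' * W - m * (2 * P)) / W\<^sup>2 = m' / W - 2 * (\<pi> * m / W)"
      unfolding PN using nz(2) by (simp add: field_simps power2_eq_square)
    moreover have "m / W * (P / W + \<rho>1 / \<rho>) = \<pi> * m / W + m * \<rho>1 / \<rho> / W"
      unfolding PN using nz by (simp add: field_simps)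
    moreover have "(N\<^sup>2 / W ^ 3 + \<zeta>1\<^sup>2 / (\<rho>\<^sup>2 * W)) * (2 / \<rho>)
        = 2 * \<kappa>\<^sup>2 / \<rho> / W + 2 * \<zeta>1\<^sup>2 / \<rho> ^ 3 / W"
      unfolding PN using nz by (simp add: field_simps eval_nat_numeral)
    moreover have "2 * \<rho>1\<^sup>2 / \<rho> ^ 3 / W + 2 * \<zeta>1\<^sup>2 / \<rho> ^ 3 / W = 2 * W / \<rho> ^ 3 / W"
      by (simp add: W distrib_left add_divide_distrib)
    ultimately show ?thesis
      using nz(2) m' by simp
  qed
  ultimately show thesis
    by (intro that) (simp_all add: vars NP m_def weighted_slope_def)
qed

lemma stability_operator_separated_mode:
  assumes "self_shrinker X"
    and c: "\<And>\<theta>. (c has_real_derivative d \<theta>) (at \<theta>)"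
    and d: "\<And>\<theta>. (d has_real_derivative - c \<theta>) (at \<theta>)"
  shows "stability_operator X (\<lambda>p. amplitude (p $ 1) * c (p $ 2)) p
    = amplitude (p $ 1) * c (p $ 2)"
proof -
  let ?s = "p $ 1"
  obtain a' where a': "(weighted_slope has_real_derivative a') (at ?s)"
    and eq: "a' + weighted_slope ?s
         * ((r' ?s * r'' ?s + z' ?s * z'' ?s) / speed_sq ?s + r' ?s / r ?s)
       - 2 / r ?s ^ 3
     + ((r' ?s * z'' ?s - z' ?s * r'' ?s)\<^sup>2 / speed_sq ?s ^ 3
         + (z' ?s)\<^sup>2 / ((r ?s)\<^sup>2 * speed_sq ?s)) * (2 / r ?s)
     = 1 / r ?s" (is "?A - ?b + ?K * _ = _")
    by (rule radial_equation[OF assms(1)])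
  have b: "((\<lambda>s. 2 / r s ^ 3) has_real_derivative - (2 * (3 * (r ?s)\<^sup>2 * r' ?s)) / (r ?s ^ 3)\<^sup>2) (at ?s)"
    by (auto intro!: derivative_eq_intros profile_DERIV simp: power2_eq_square)
  let ?E = "exp (((r ?s)\<^sup>2 + (z ?s)\<^sup>2) / 4)"
  have "drift_laplacian X (\<lambda>p. amplitude (p $ 1) * c (p $ 2)) p
      = ?E * (?A * c (p $ 2) + ?b * (- c (p $ 2)))"
    unfolding drift_laplacian_def weighted_gradient[OF c] unfolding X_norm
    by (subst X_divergence[OF a' b c d]) simp
  also have "\<dots> = ?E * c (p $ 2) * (?A - ?b)"
    by (simp add: algebra_simps)
  also have "?A - ?b = 1 / r ?s - ?K * (2 / r ?s)"
    using eq by linarith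
  also have "?E * c (p $ 2) * (1 / r ?s - ?K * (2 / r ?s)) = amplitude ?s * c (p $ 2) * (1/2 - ?K)"
    by (simp add: amplitude_def field_simps)
  finally show ?thesis
    unfolding stability_operator_def X_second_form_norm_sq
    by (simp add: algebra_simps)
qed

lemma separated_mode_eigenfunction:
  assumes "self_shrinker X"
    and c: "\<And>\<theta>. (c has_real_derivative d \<theta>) (at \<theta>)"
    and d: "\<And>\<theta>. (d has_real_derivative - c \<theta>) (at \<theta>)"
    and "smooth_real c" "\<And>\<theta>. c (\<theta> + 2 * pi) = c \<theta>" "c \<theta>\<^sub>0 \<noteq> 0"
  shows "stability_eigenfunction (torus_periods T) X (- 1)
    (\<lambda>p. 2 / r (p $ 1) * exp ((norm (X p))\<^sup>2 / 4) * c (p $ 2))"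
proof -
  have f: "(\<lambda>p. 2 / r (p $ 1) * exp ((norm (X p))\<^sup>2 / 4) * c (p $ 2))
      = (\<lambda>p. amplitude (p $ 1) * c (p $ 2))"
    by (simp add: amplitude_def X_norm)
  have "smooth (\<lambda>p. (amplitude (p $ 1) * c (p $ 2)) *\<^sub>R (1::real))"
    using smooth_amplitude assms(4) by (rule smooth_separated)
  moreover have "amplitude (s + T) = amplitude s" for s
    using profile by (simp add: closed_profile_curve_def amplitude_def)
  then have "periodic_under (torus_periods T) (\<lambda>p. amplitude (p $ 1) * c (p $ 2))"
    using assms(5) by (simp add: periodic_under_def torus_periods_def axis_def)
  moreover have "amplitude (vector [0, \<theta>\<^sub>0] $ 1) * c ((vector [0, \<theta>\<^sub>0] :: real^2) $ 2) \<noteq> 0"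
    using assms(6) by (simp add: amplitude_def)
  then have "\<exists>p. amplitude (p $ 1) * c ((p :: real^2) $ 2) \<noteq> 0"
    by (metis vector_2)
  ultimately show ?thesis
    using stability_operator_separated_mode[OF assms(1) c d]
    unfolding f stability_eigenfunction_def by simp
qed

end

theorem theorem6p1:
  fixes T :: real and r z :: "real \<Rightarrow> real" and X :: "real^2 \<Rightarrow> real^3"
  assumes "closed_profile_curve T r z"
    and "X = rotation_surface r z"
    and "self_shrinker X"
  shows "stability_eigenfunction (torus_periods T) X (- 1)
           (\<lambda>p. 2 / r (p $ 1) * exp ((norm (X p))\<^sup>2 / 4) * cos (p $ 2)) \<and>
         stability_eigenfunction (torus_periods T) X (- 1)
           (\<lambda>p. 2 / r (p $ 1) * exp ((norm (X p))\<^sup>2 / 4) * sin (p $ 2))"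
proof -
  interpret profile_curve T r z
    by unfold_locales (rule assms(1))
  have shrinker: "self_shrinker (rotation_surface r z)"
    using assms(2,3) by simp
  have "smooth_real cos" "smooth_real sin"
    using smooth_real_trig[of 1 0] smooth_real_trig[of 0 1] by simp_all
  then show ?thesis
    unfolding assms(2)
    by (intro conjI
        separated_mode_eigenfunction[OF shrinker, of cos "\<lambda>\<theta>. - sin \<theta>" 0]
        separated_mode_eigenfunction[OF shrinker, of sin cos "pi / 2"])
      (auto intro!: derivative_eq_intros)
qed

end
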